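(* Let $\Gamma$ be a metrized graph. For each edge $e_i$ such that $\Gamma-e_i$ is connected, $$z(\Gamma)=\frac{L_i^2}{L_i+R_i}+\frac{L_i}{L_i+R_i}z(\Gamma-e_i)+\frac{R_i}{L_i+R_i}z(\overline{\Gamma}_i).$$
   Context: A metrized graph is a finite connected graph (multiple edges and self-loops allowed) whose edges $e_j$ are identified with closed segments of lengths $L_j>0$; its vertex set is finite, nonempty, and contains all points of valence $\neq2$. For an edge $e_j$ of a metrized graph $G$, $G-e_j$ is $G$ with the interior of $e_j$ removed and $R_j$ (or $R_j(G)$) is the effective resistance between the endpoints of $e_j$ in $G-e_j$, edges being resistors with resistance equal to length; if $G-e_j$ is disconnected, $R_j=\infty$ and $\frac{L_j^2}{L_j+R_j}:=0$. $z(G)=\sum_{e_j\in E(G)}\frac{L_j^2}{L_j+R_j(G)}$. $\overline{\Gamma}_i$ is obtained from $\Gamma$ by contracting $e_i$ to a point. *)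

theory Defs
  imports Complex_Main "HOL-Library.Extended_Real" "Graph_Theory.Digraph_Component"
begin

text \<open>
  A metrized graph is given by its combinatorial data: a finite connected multigraph (loops and
  parallel edges allowed) with a positive length for every edge.  The tail and head of an arc only
  name the two endpoints of an undirected edge; all notions below are independent of this choice of
  orientation.  Connectedness is that of the underlying undirected graph and includes that the
  vertex set is nonempty.  Every point in the interior of an edge has valence 2, so the vertex set
  contains all points of valence different from 2 without further assumptions.

  The name \<open>connected\<close> is qualified because it also denotes topological connectedness.
\<close>

locale metrized_graph = fin_digraph G for G :: "('a, 'b) pre_digraph" +
  fixes L :: "'b \<Rightarrow> real"
  assumes connected_G: "Digraph_Component.connected G"
    and length_pos: "e \<in> arcs G \<Longrightarrow> 0 < L e"

text \<open>
  Net current leaving the vertex \<open>v\<close> along its edges when the vertices are held at potential \<open>f\<close>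
  and every edge is a resistor with resistance equal to its length (Ohm's law).  A loop is both an
  outgoing and an incoming arc and contributes 0.
\<close>

definition net_current ::
    "('a, 'b) pre_digraph \<Rightarrow> ('b \<Rightarrow> real) \<Rightarrow> ('a \<Rightarrow> real) \<Rightarrow> 'a \<Rightarrow> real" where
  "net_current G L f v =
     (\<Sum>e\<in>out_arcs G v. (f v - f (head G e)) / L e) +
     (\<Sum>e\<in>in_arcs G v. (f v - f (tail G e)) / L e)"

text \<open>
  \<open>f\<close> is a potential for a unit current entering the network at \<open>p\<close> and leaving it at \<open>q\<close>
  (Kirchhoff's current law).
\<close>

definition unit_current_potential ::
    "('a, 'b) pre_digraph \<Rightarrow> ('b \<Rightarrow> real) \<Rightarrow> 'a \<Rightarrow> 'a \<Rightarrow> ('a \<Rightarrow> real) \<Rightarrow> bool" where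
  "unit_current_potential G L p q f \<longleftrightarrow>
     (\<forall>v\<in>verts G. net_current G L f v = (if v = p then 1 else 0) - (if v = q then 1 else 0))"

text \<open>
  On a metrized graph such a potential exists and is unique up to an additive constant on the
  vertices, so the potential difference is well defined; it is 0 if \<open>p = q\<close>.
\<close>

definition effective_resistance ::
    "('a, 'b) pre_digraph \<Rightarrow> ('b \<Rightarrow> real) \<Rightarrow> 'a \<Rightarrow> 'a \<Rightarrow> real" where
  "effective_resistance G L p q =
     (THE r. \<exists>f. unit_current_potential G L p q f \<and> r = f p - f q)"

definition edge_resistance ::
    "('a, 'b) pre_digraph \<Rightarrow> ('b \<Rightarrow> real) \<Rightarrow> 'b \<Rightarrow> ereal" where
  "edge_resistance G L e =
     (if Digraph_Component.connected (pre_digraph.del_arc G e)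
      then ereal (effective_resistance (pre_digraph.del_arc G e) L (tail G e) (head G e))
      else \<infinity>)"

definition z_invariant :: "('a, 'b) pre_digraph \<Rightarrow> ('b \<Rightarrow> real) \<Rightarrow> real" where
  "z_invariant G L =
     (\<Sum>e\<in>arcs G. if edge_resistance G L e = \<infinity> then 0
                  else (L e)\<^sup>2 / (L e + real_of_ereal (edge_resistance G L e)))"

text \<open>
  Contraction of the edge \<open>e\<close> to a point: \<open>e\<close> is removed and its two endpoints are identified, the
  resulting vertex being named after the tail of \<open>e\<close>.  Other edges between the endpoints of \<open>e\<close>
  become loops.  Contracting a loop just removes it.
\<close>

definition contract_arc :: "('a, 'b) pre_digraph \<Rightarrow> 'b \<Rightarrow> ('a, 'b) pre_digraph" where
  "contract_arc G e =
     (let \<pi> = (\<lambda>v. if v = head G e then tail G e else v)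
      in \<lparr> verts = \<pi> ` verts G, arcs = arcs G - {e},
           tail = \<pi> \<circ> tail G, head = \<pi> \<circ> head G \<rparr>)"

end

theory Submission
  imports Defs
begin

text \<open>
  Let \<open>r G p q\<close> be the effective resistance between \<open>p\<close> and \<open>q\<close>.  By the parallel law,
  \<open>L\<^sub>j\<^sup>2 / (L\<^sub>j + R\<^sub>j) = L\<^sub>j - r G p\<^sub>j q\<^sub>j\<close>, where \<open>p\<^sub>j, q\<^sub>j\<close> are the ends of \<open>e\<^sub>j\<close>; this also holds
  for a bridge.  Hence \<open>z G\<close> is the sum of the numbers \<open>L\<^sub>j - r G p\<^sub>j q\<^sub>j\<close>.  Let \<open>s\<close> be the potential
  difference across the ends of \<open>e\<^sub>i\<close> caused by a unit current from \<open>p\<close> to \<open>q\<close> in \<open>H = \<Gamma> - e\<^sub>i\<close>.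
  Superposing a multiple of the potential of a unit current between the ends of \<open>e\<^sub>i\<close> and using
  reciprocity gives \<open>r \<Gamma> p q = r H p q - s\<^sup>2 / (L\<^sub>i + R\<^sub>i)\<close>, and \<open>r H p q - s\<^sup>2 / R\<^sub>i\<close> after
  contraction.  So \<open>r \<Gamma>\<close> is the convex combination of the two other resistances with weights
  \<open>L\<^sub>i / (L\<^sub>i + R\<^sub>i)\<close> and \<open>R\<^sub>i / (L\<^sub>i + R\<^sub>i)\<close>, and the theorem holds edge by edge.
\<close>

section \<open>Connectedness by cuts\<close>

text \<open>On the vertices these sets are the unions of connected components. \<open>S\<close> may
  contain points outside \<open>verts G\<close>, so that complements stay closed.\<close>

definition arc_closed :: "('a, 'b) pre_digraph \<Rightarrow> 'a set \<Rightarrow> bool" where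
  "arc_closed G S \<longleftrightarrow> (\<forall>e\<in>arcs G. tail G e \<in> S \<longleftrightarrow> head G e \<in> S)"

text \<open>Lying in one component, phrased by cuts instead of paths: deleting an arc then merely
  drops one condition on \<open>S\<close>.\<close>

definition unseparated :: "('a, 'b) pre_digraph \<Rightarrow> 'a \<Rightarrow> 'a \<Rightarrow> bool" where
  "unseparated G p q \<longleftrightarrow> (\<forall>S. arc_closed G S \<longrightarrow> (p \<in> S \<longleftrightarrow> q \<in> S))"

lemma arc_closed_Compl: "arc_closed G S \<Longrightarrow> arc_closed G (- S)"
  by (simp add: arc_closed_def)

lemma arc_closed_Int: "arc_closed G S \<Longrightarrow> arc_closed G T \<Longrightarrow> arc_closed G (S \<inter> T)"
  by (simp add: arc_closed_def)

lemma arc_closed_del_arc_iff: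
  assumes "e \<in> arcs G"
  shows "arc_closed G S \<longleftrightarrow>
    arc_closed (pre_digraph.del_arc G e) S \<and> (tail G e \<in> S \<longleftrightarrow> head G e \<in> S)"
  using assms by (auto simp: arc_closed_def pre_digraph.del_arc_simps)

lemma unseparated_sym: "unseparated G p q \<Longrightarrow> unseparated G q p"
  by (simp add: unseparated_def)

lemma unseparated_trans: "unseparated G p q \<Longrightarrow> unseparated G q r \<Longrightarrow> unseparated G p r"
  by (simp add: unseparated_def)

lemma not_unseparatedE:
  assumes "\<not> unseparated G p q"
  obtains S where "arc_closed G S" "p \<in> S" "q \<notin> S"
proof -
  obtain S where S: "arc_closed G S" "p \<in> S \<longleftrightarrow> q \<notin> S"
    using assms by (auto simp: unseparated_def)
  show thesis
  proof (cases "p \<in> S")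
    case False
    then show thesis
      using S that[OF arc_closed_Compl] by simp
  qed (use S that in blast)
qed

text \<open>The cut form of the fact that a path from \<open>p\<close> to \<open>q\<close> can be
  chosen to avoid \<open>e\<close> or to cross it once, in one of the two directions.\<close>

lemma unseparated_del_arc_cases:
  assumes e: "e \<in> arcs G" and pq: "unseparated G p q"
  defines "H \<equiv> pre_digraph.del_arc G e" and "a \<equiv> tail G e" and "b \<equiv> head G e"
  obtains "unseparated H p q"
    | "unseparated H p a" "unseparated H b q"
    | "unseparated H p b" "unseparated H a q"
proof -
  have near_end: "unseparated H x a \<or> unseparated H x b"
    if xy: "unseparated G x y" "\<not> unseparated H x y" for x y
  proof (rule ccontr)
    assume "\<not> ?thesis"
    then have no_end: "\<not> unseparated H x a" "\<not> unseparated H x b"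
      by auto
    obtain S where "arc_closed H S" "x \<in> S" "a \<notin> S"
      using no_end(1) by (rule not_unseparatedE)
    moreover obtain T where "arc_closed H T" "x \<in> T" "b \<notin> T"
      using no_end(2) by (rule not_unseparatedE)
    moreover obtain U where "arc_closed H U" "x \<in> U" "y \<notin> U"
      using xy(2) by (rule not_unseparatedE)
    \<comment> \<open>The intersection of the three cuts misses both ends of \<open>e\<close>, so it
      is closed in \<open>G\<close> as well and separates \<open>x\<close> from \<open>y\<close>
      there.\<close>
    ultimately have sep: "arc_closed H (S \<inter> T \<inter> U)" "x \<in> S \<inter> T \<inter> U"
      "y \<notin> S \<inter> T \<inter> U" "a \<notin> S \<inter> T \<inter> U" "b \<notin> S \<inter> T \<inter> U"
      by (simp_all add: arc_closed_Int)
    then have "arc_closed G (S \<inter> T \<inter> U)"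
      unfolding arc_closed_del_arc_iff[OF e] H_def a_def b_def by simp blast
    with xy(1) have "x \<in> S \<inter> T \<inter> U \<longleftrightarrow> y \<in> S \<inter> T \<inter> U"
      by (simp only: unseparated_def)
    then show False
      using sep(2,3) by simp
  qed
  show thesis
  proof (cases "unseparated H p q")
    case True
    then show thesis by (rule that(1))
  next
    case False
    then have "\<not> unseparated H q p"
      by (auto dest: unseparated_sym)
    then have "unseparated H q a \<or> unseparated H q b"
      by (rule near_end[OF unseparated_sym[OF pq]])
    then have q: "unseparated H a q \<or> unseparated H b q"
      by (auto dest: unseparated_sym)
    have "unseparated H p a \<or> unseparated H p b"
      by (rule near_end[OF pq False])
    \<comment> \<open>If \<open>p\<close> and \<open>q\<close> hung on the same end of
      \<open>e\<close>, transitivity would join them in \<open>H\<close>.\<close>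
    then show thesis
    proof
      assume pa: "unseparated H p a"
      then have "\<not> unseparated H a q"
        using False unseparated_trans[OF pa] by auto
      then show thesis
        using that(2)[OF pa] q by simp
    next
      assume pb: "unseparated H p b"
      then have "\<not> unseparated H b q"
        using False unseparated_trans[OF pb] by auto
      then show thesis
        using that(3)[OF pb] q by simp
    qed
  qed
qed

text \<open>A path cannot leave a closed set; conversely the set of vertices reachable from
  \<open>p\<close> is itself closed and so contains every \<open>q\<close> not separated from
  \<open>p\<close>.\<close>

lemma (in fin_digraph) connected_iff_unseparated:
  "Digraph_Component.connected G \<longleftrightarrow>
    verts G \<noteq> {} \<and> (\<forall>p\<in>verts G. \<forall>q\<in>verts G. unseparated G p q)"
proof -
  interpret S: pair_fin_digraph "mk_symmetric G" ..
  have adj: "(x, y) \<in> parcs (mk_symmetric G) \<longleftrightarrow>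
      (\<exists>e\<in>arcs G. x = tail G e \<and> y = head G e \<or> x = head G e \<and> y = tail G e)" for x y
    by (auto simp: parcs_mk_symmetric)
  have "unseparated G p q" if "p \<rightarrow>\<^sup>*\<^bsub>with_proj (mk_symmetric G)\<^esub> q" for p q
    unfolding unseparated_def
  proof (intro allI impI)
    fix S assume S: "arc_closed G S"
    from that show "p \<in> S \<longleftrightarrow> q \<in> S"
    proof (induction rule: S.converse_reachable_induct)
      case (step x y)
      then show ?case
        using S unfolding adj arc_closed_def by fast
    qed simp
  qed
  moreover have "p \<rightarrow>\<^sup>*\<^bsub>with_proj (mk_symmetric G)\<^esub> q"
    if p: "p \<in> verts G" and pq: "unseparated G p q" for p q
  proof -
    let ?S = "{v. p \<rightarrow>\<^sup>*\<^bsub>with_proj (mk_symmetric G)\<^esub> v}"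
    have "tail G e \<in> ?S \<longleftrightarrow> head G e \<in> ?S" if "e \<in> arcs G" for e
    proof -
      have "(tail G e, head G e) \<in> parcs (mk_symmetric G)"
        "(head G e, tail G e) \<in> parcs (mk_symmetric G)"
        using that by (auto simp: parcs_mk_symmetric)
      note S.reachable_adj_trans[OF _ this(1)] S.reachable_adj_trans[OF _ this(2)]
      then show ?thesis
        by (simp only: mem_Collect_eq) (rule iffI)
    qed
    then have "arc_closed G ?S"
      unfolding arc_closed_def by (rule ballI)
    moreover have "p \<in> ?S"
      using p by simp
    ultimately have "q \<in> ?S"
      using pq unfolding unseparated_def by (simp only:)
    then show ?thesis
      by (rule CollectD)
  qed
  ultimately have "unseparated G p q \<longleftrightarrow> p \<rightarrow>\<^sup>*\<^bsub>with_proj (mk_symmetric G)\<^esub> q"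
    if "p \<in> verts G" for p q
    using that by (intro iffI)
  then show ?thesis
    by (simp add: connected_def strongly_connected_def)
qed

section \<open>Potentials\<close>

text \<open>Connectedness is left out so that every deletion, even of a bridge, stays in the
  locale.\<close>

locale resistor_network = fin_digraph G for G :: "('a, 'b) pre_digraph" +
  fixes L :: "'b \<Rightarrow> real"
  assumes length_pos: "e \<in> arcs G \<Longrightarrow> 0 < L e"
begin

lemma resistor_network_del_arc: "resistor_network (del_arc e) L"
proof -
  interpret H: fin_digraph "del_arc e"
    by (rule fin_digraph_del_arc)
  show ?thesis
    by unfold_locales (simp add: length_pos)
qed

text \<open>As one sum of arc current times signed incidence, the net current can be treated arc by
  arc: linearity, deletion and summation by parts become termwise. The two incidences of a loop
  cancel.\<close>

lemma net_current_eq_sum_arcs: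
  "net_current G L f v =
     (\<Sum>e\<in>arcs G. (f (tail G e) - f (head G e)) / L e *
       ((if v = tail G e then 1 else 0) - (if v = head G e then 1 else 0)))"
proof -
  have "(\<Sum>e\<in>out_arcs G v. (f v - f (head G e)) / L e) =
      (\<Sum>e\<in>arcs G. if v = tail G e then (f (tail G e) - f (head G e)) / L e else 0)"
    by (rule sum.mono_neutral_cong_left) auto
  moreover have "(\<Sum>e\<in>in_arcs G v. (f v - f (tail G e)) / L e) =
      (\<Sum>e\<in>arcs G. if v = head G e then - (f (tail G e) - f (head G e)) / L e else 0)"
    by (rule sum.mono_neutral_cong_left) auto
  ultimately show ?thesis
    unfolding net_current_def by (auto simp: sum.distrib[symmetric] intro!: sum.cong)
qed

lemma net_current_add_mult:
  "net_current G L (\<lambda>v. f v + c * g v) w = net_current G L f w + c * net_current G L g w"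
  unfolding net_current_eq_sum_arcs sum_distrib_left sum.distrib[symmetric]
  by (intro sum.cong refl) (simp add: add_divide_distrib diff_divide_distrib algebra_simps)

lemma net_current_indicator:
  assumes "arc_closed G S"
  shows "net_current G L (\<lambda>v. if v \<in> S then c else 0) w = 0"
  unfolding net_current_eq_sum_arcs
  by (intro sum.neutral) (use assms in \<open>auto simp: arc_closed_def\<close>)

lemma net_current_del_arc:
  assumes "e \<in> arcs G"
  shows "net_current G L f v = net_current (del_arc e) L f v +
    (f (tail G e) - f (head G e)) / L e *
      ((if v = tail G e then 1 else 0) - (if v = head G e then 1 else 0))"
proof -
  interpret H: resistor_network "del_arc e" L
    by (rule resistor_network_del_arc)
  show ?thesis
    unfolding net_current_eq_sum_arcs H.net_current_eq_sum_arcs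
    by (subst sum.remove[OF finite_arcs assms]) simp
qed

section \<open>The Dirichlet form, reciprocity and uniqueness of potential differences\<close>

definition energy :: "('a \<Rightarrow> real) \<Rightarrow> ('a \<Rightarrow> real) \<Rightarrow> real" where
  "energy f g = (\<Sum>e\<in>arcs G. (f (tail G e) - f (head G e)) * (g (tail G e) - g (head G e)) / L e)"

lemma energy_commute: "energy f g = energy g f"
  unfolding energy_def by (simp add: mult.commute)

text \<open>Summation by parts, the discrete Green formula.\<close>

lemma sum_net_current: "(\<Sum>v\<in>verts G. net_current G L f v * g v) = energy f g"
proof -
  have "(\<Sum>v\<in>verts G. net_current G L f v * g v) =
    (\<Sum>e\<in>arcs G. \<Sum>v\<in>verts G. (f (tail G e) - f (head G e)) / L e *
       ((if v = tail G e then g v else 0) - (if v = head G e then g v else 0)))"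
    unfolding net_current_eq_sum_arcs sum_distrib_right
    by (subst sum.swap) (intro sum.cong refl, auto)
  also have "\<dots> = energy f g"
    unfolding energy_def
    by (intro sum.cong refl) (simp only: sum_distrib_left[symmetric] sum_subtractf, simp)
  finally show ?thesis .
qed

lemma energy_potential:
  assumes "unit_current_potential G L p q f" "p \<in> verts G" "q \<in> verts G"
  shows "energy f g = g p - g q"
proof -
  have "energy f g =
      (\<Sum>v\<in>verts G. (if v = p then g v else 0) - (if v = q then g v else 0))"
    unfolding sum_net_current[symmetric]
    by (intro sum.cong refl) (use assms(1) in \<open>auto simp: unit_current_potential_def\<close>)
  then show ?thesis
    using assms(2,3) by (simp add: sum_subtractf)
qed

text \<open>Both sides evaluate the symmetric form \<open>energy f g\<close>. With equal terminals
  this is the uniqueness behind \<open>effective_resistance\<close>.\<close>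

lemma reciprocity:
  assumes "unit_current_potential G L p q f" "p \<in> verts G" "q \<in> verts G"
    and "unit_current_potential G L a b g" "a \<in> verts G" "b \<in> verts G"
  shows "f a - f b = g p - g q"
  using energy_potential[OF assms(1-3), of g] energy_potential[OF assms(4-6), of f]
  by (simp add: energy_commute)

lemma effective_resistance_eq:
  assumes "unit_current_potential G L p q f" "p \<in> verts G" "q \<in> verts G"
  shows "effective_resistance G L p q = f p - f q"
  unfolding effective_resistance_def
proof (rule the_equality)
  show "\<exists>g. unit_current_potential G L p q g \<and> f p - f q = g p - g q"
    using assms(1) by (intro exI[of _ f] conjI refl)
next
  fix r assume "\<exists>g. unit_current_potential G L p q g \<and> r = g p - g q"
  then obtain g where "unit_current_potential G L p q g" "r = g p - g q"
    by (elim exE conjE)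
  then show "r = f p - f q"
    using reciprocity[OF _ assms(2,3) assms] by simp
qed

lemma potential_nonneg:
  assumes "unit_current_potential G L p q f" "p \<in> verts G" "q \<in> verts G"
  shows "0 \<le> f p - f q"
  unfolding energy_potential[OF assms, symmetric] energy_def
  by (intro sum_nonneg) (simp add: length_pos less_imp_le)

text \<open>Zero energy would stop the current in every arc, against the unit current leaving
  \<open>p\<close>.\<close>

lemma potential_pos:
  assumes f: "unit_current_potential G L p q f" "p \<in> verts G" "q \<in> verts G" and "p \<noteq> q"
  shows "0 < f p - f q"
proof (rule ccontr)
  assume "\<not> ?thesis"
  then have "energy f f = 0"
    using potential_nonneg[OF f] energy_potential[OF f, of f] by simp
  then have "\<forall>e\<in>arcs G. (f (tail G e) - f (head G e)) * (f (tail G e) - f (head G e)) / L e = 0"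
    unfolding energy_def
    by (subst (asm) sum_nonneg_eq_0_iff) (simp_all add: length_pos less_imp_le)
  then have "net_current G L f p = 0"
    unfolding net_current_eq_sum_arcs by (intro sum.neutral) auto
  then show False
    using f \<open>p \<noteq> q\<close> by (simp add: unit_current_potential_def)
qed

section \<open>Superposition and existence of potentials\<close>

lemma unit_current_potential_join:
  assumes "unit_current_potential G L p q f" "unit_current_potential G L q r g"
  shows "unit_current_potential G L p r (\<lambda>v. f v + g v)"
  using assms net_current_add_mult[of f 1 g] by (simp add: unit_current_potential_def)

lemma unit_current_potential_swap:
  assumes "unit_current_potential G L p q f"
  shows "unit_current_potential G L q p (\<lambda>v. - f v)"
  \<comment> \<open>The function \<open>- f\<close> is taken as \<open>0 + (-1) * f\<close>; the
    zero function is an indicator over the empty set and carries no current.\<close>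
  using assms net_current_add_mult[of "\<lambda>_. 0" "-1" f] net_current_indicator[of "{}" 0]
  by (simp add: unit_current_potential_def arc_closed_def)

text \<open>Adding \<open>t * g\<close> injects an extra current \<open>t\<close> at the tail of
  \<open>e\<close> and extracts it at the head. The factor solves
  \<open>(s + t * R) / L e = - t\<close>, where \<open>s\<close> and \<open>R\<close> are the drops
  of \<open>h\<close> and \<open>g\<close> across \<open>e\<close>, so that \<open>e\<close> carries
  exactly this excess back.\<close>

lemma unit_current_potential_add_arc:
  assumes e: "e \<in> arcs G"
    and g: "unit_current_potential (del_arc e) L (tail G e) (head G e) g"
    and h: "unit_current_potential (del_arc e) L p q h"
  shows "unit_current_potential G L p q (\<lambda>v. h v +
    (- (h (tail G e) - h (head G e)) / (L e + (g (tail G e) - g (head G e)))) * g v)"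
    (is "unit_current_potential G L p q (\<lambda>v. h v + ?t * g v)")
proof -
  interpret H: resistor_network "del_arc e" L
    by (rule resistor_network_del_arc)
  let ?R = "g (tail G e) - g (head G e)" and ?s = "h (tail G e) - h (head G e)"
  have "0 \<le> ?R"
    using e by (intro H.potential_nonneg[OF g]) auto
  then have "L e + ?R > 0" "L e > 0"
    using length_pos[OF e] by auto
  moreover have "(s + (- s / (l + r)) * r) / l = - (- s / (l + r))"
    if "l + r > 0" "l > 0" for s l r :: real
    using that by (simp add: divide_simps) (simp add: algebra_simps)
  ultimately have "(?s + ?t * ?R) / L e = - ?t"
    by blast
  moreover have "(h (tail G e) + ?t * g (tail G e)) - (h (head G e) + ?t * g (head G e)) =
      ?s + ?t * ?R"
    by (simp only: right_diff_distrib)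
  ultimately have drop:
    "((h (tail G e) + ?t * g (tail G e)) - (h (head G e) + ?t * g (head G e))) / L e = - ?t"
    by (simp only:)
  show ?thesis
    unfolding unit_current_potential_def
  proof
    fix v assume "v \<in> verts G"
    then have "net_current (del_arc e) L g v =
        (if v = tail G e then 1 else 0) - (if v = head G e then 1 else 0)"
      and "net_current (del_arc e) L h v = (if v = p then 1 else 0) - (if v = q then 1 else 0)"
      using g h by (simp_all only: unit_current_potential_def verts_del_arc)
    then show "net_current G L (\<lambda>v. h v + ?t * g v) v =
        (if v = p then 1 else 0) - (if v = q then 1 else 0)"
      unfolding net_current_del_arc[OF e] drop H.net_current_add_mult
      by (simp only: mult_minus_left add.assoc add.right_inverse add_0_right)
  qed
qed

text \<open>A step of height \<open>L e\<close> across the cut drives a unit current through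
  \<open>e\<close> and none through any other arc.\<close>

lemma unit_current_potential_bridge:
  assumes "e \<in> arcs G" "arc_closed (del_arc e) S" "tail G e \<in> S" "head G e \<notin> S"
  shows "unit_current_potential G L (tail G e) (head G e) (\<lambda>v. if v \<in> S then L e else 0)"
proof -
  interpret H: resistor_network "del_arc e" L
    by (rule resistor_network_del_arc)
  show ?thesis
    using assms length_pos[of e] H.net_current_indicator[of S "L e"]
    by (simp add: unit_current_potential_def net_current_del_arc[OF assms(1)])
qed

end

text \<open>Induction on the number of arcs, removing one arc \<open>e\<close>. Since this may
  disconnect the network, the claim is about unseparated terminals in an arbitrary network.\<close>

lemma unit_current_potential_exists:
  assumes "resistor_network G L" "unseparated G p q"
  shows "\<exists>f. unit_current_potential G L p q f"
  using assms
proof (induction "card (arcs G)" arbitrary: G p q rule: less_induct)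
  case less
  interpret resistor_network G L
    by (fact less.prems(1))
  show ?case
  proof (cases "arcs G = {}")
    case True
    \<comment> \<open>Without arcs every set is closed, so only equal points are
      unseparated.\<close>
    then have "arc_closed G {p}"
      by (simp add: arc_closed_def)
    then have "p = q"
      using less.prems(2) by (auto simp: unseparated_def)
    then have "unit_current_potential G L p q (\<lambda>_. 0)"
      by (simp add: unit_current_potential_def net_current_def)
    then show ?thesis
      by blast
  next
    case False
    then obtain e where e: "e \<in> arcs G"
      by blast
    interpret H: resistor_network "del_arc e" L
      by (rule resistor_network_del_arc)
    have "card (arcs (del_arc e)) < card (arcs G)"
      using card_Diff1_less[OF finite_arcs e] by (simp only: arcs_del_arc)
    then have IH: "\<exists>f. unit_current_potential (del_arc e) L x y f"
      if "unseparated (del_arc e) x y" for x y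
      using less.hyps H.resistor_network_axioms that by blast
    let ?a = "tail G e" and ?b = "head G e"
    show ?thesis
    proof (cases "unseparated (del_arc e) ?a ?b")
      case True
      \<comment> \<open>If the ends of \<open>e\<close> stay unseparated, \<open>G\<close> and
        \<open>del_arc e\<close> have the same closed sets.\<close>
      then have "unseparated (del_arc e) p q"
        using less.prems(2) e unfolding unseparated_def by (simp add: arc_closed_del_arc_iff)
      then obtain g h where g: "unit_current_potential (del_arc e) L ?a ?b g"
        and h: "unit_current_potential (del_arc e) L p q h"
        using IH True by blast
      show ?thesis
        by (rule exI, rule unit_current_potential_add_arc[OF e g h])
    next
      case False
      then obtain S where S: "arc_closed (del_arc e) S" "?a \<in> S" "?b \<notin> S"
        by (rule not_unseparatedE)
      \<comment> \<open>Shifting the potential on the side \<open>S\<close> of the bridge makes the current through it vanish.\<close>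
      have lift: "\<exists>f. unit_current_potential G L x y f" if xy: "unseparated (del_arc e) x y" for x y
      proof -
        obtain h where h: "unit_current_potential (del_arc e) L x y h"
          using IH[OF xy] by blast
        let ?f = "\<lambda>v. h v + 1 * (if v \<in> S then h ?b - h ?a else 0)"
        have "net_current (del_arc e) L ?f v = net_current (del_arc e) L h v" for v
          unfolding H.net_current_add_mult H.net_current_indicator[OF S(1)] by simp
        moreover have "?f ?a - ?f ?b = 0"
          using S by simp
        ultimately have "net_current G L ?f v = net_current (del_arc e) L h v" for v
          unfolding net_current_del_arc[OF e] by simp
        then have "unit_current_potential G L x y ?f"
          using h by (simp add: unit_current_potential_def)
        then show ?thesis
          by blast
      qed
      note bridge = unit_current_potential_bridge[OF e S]
      \<comment> \<open>The current either avoids the bridge or is joined from three pieces, the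
        middle one crossing the bridge forwards or backwards.\<close>
      from e less.prems(2) show ?thesis
      proof (cases rule: unseparated_del_arc_cases)
        case 1
        then show ?thesis by (rule lift)
      next
        case 2
        then obtain f g
          where f: "unit_current_potential G L p ?a f" and g: "unit_current_potential G L ?b q g"
          using lift by blast
        show ?thesis
          by (rule exI, rule unit_current_potential_join[OF
                unit_current_potential_join[OF f bridge] g])
      next
        case 3
        then obtain f g
          where f: "unit_current_potential G L p ?b f" and g: "unit_current_potential G L ?a q g"
          using lift by blast
        show ?thesis
          by (rule exI, rule unit_current_potential_join[OF
                unit_current_potential_join[OF f unit_current_potential_swap[OF bridge]] g])
      qed
    qed
  qed
qed

section \<open>Deletion and contraction\<close>

context metrized_graph
begin

sublocale resistor_network G L
  by unfold_locales (rule length_pos)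

section \<open>Resistances in connected networks and the parallel law\<close>

lemma verts_unseparated: "p \<in> verts G \<Longrightarrow> q \<in> verts G \<Longrightarrow> unseparated G p q"
  using connected_G by (simp add: connected_iff_unseparated)

lemma obtain_potential:
  assumes "p \<in> verts G" "q \<in> verts G"
  obtains f where "unit_current_potential G L p q f"
    "effective_resistance G L p q = f p - f q"
proof -
  obtain f where "unit_current_potential G L p q f"
    using unit_current_potential_exists[OF resistor_network_axioms verts_unseparated[OF assms]]
    by blast
  then show thesis
    using that effective_resistance_eq assms by blast
qed

lemma metrized_graph_del_arc:
  assumes "Digraph_Component.connected (del_arc e)"
  shows "metrized_graph (del_arc e) L"
proof -
  interpret H: resistor_network "del_arc e" L
    by (rule resistor_network_del_arc)
  show ?thesis
    by unfold_locales (use assms length_pos in auto)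
qed

text \<open>The number subtracted is the effect of the rank one perturbation by the arc \<open>e\<close>.\<close>

lemma effective_resistance_del_arc:
  assumes e: "e \<in> arcs G" and conn: "Digraph_Component.connected (del_arc e)"
    and pq: "p \<in> verts G" "q \<in> verts G"
    and h: "unit_current_potential (del_arc e) L p q h"
  shows "effective_resistance G L p q = h p - h q - (h (tail G e) - h (head G e))\<^sup>2 /
    (L e + effective_resistance (del_arc e) L (tail G e) (head G e))"
proof -
  interpret H: metrized_graph "del_arc e" L
    using conn by (rule metrized_graph_del_arc)
  let ?a = "tail G e" and ?b = "head G e"
  obtain g where g: "unit_current_potential (del_arc e) L ?a ?b g"
    and R: "effective_resistance (del_arc e) L ?a ?b = g ?a - g ?b"
    using H.obtain_potential[of ?a ?b] e by auto
  \<comment> \<open>Reciprocity turns the drop of \<open>g\<close> between \<open>p\<close> and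
    \<open>q\<close> into that of \<open>h\<close> across \<open>e\<close>; this makes the
    correction a square.\<close>
  have s: "h ?a - h ?b = g p - g q"
    using H.reciprocity[OF h _ _ g] pq e by simp
  let ?t = "- (h ?a - h ?b) / (L e + (g ?a - g ?b))"
  have "effective_resistance G L p q = (h p + ?t * g p) - (h q + ?t * g q)"
    by (rule effective_resistance_eq[OF unit_current_potential_add_arc[OF e g h] pq])
  also have "\<dots> = h p - h q + ?t * (g p - g q)"
    by (simp only: right_diff_distrib)
  also have "\<dots> = h p - h q - (h ?a - h ?b)\<^sup>2 / (L e + (g ?a - g ?b))"
    unfolding s[symmetric] power2_eq_square by (simp del: minus_diff_eq)
  finally show ?thesis
    unfolding R .
qed

text \<open>The whole current has to pass through \<open>e\<close>. Hence a bridge contributes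
  \<open>L e - L e = 0\<close>, in accordance with the convention for infinite
  \<open>R\<close>.\<close>

lemma effective_resistance_bridge:
  assumes e: "e \<in> arcs G" and "\<not> Digraph_Component.connected (del_arc e)"
  shows "effective_resistance G L (tail G e) (head G e) = L e"
proof -
  interpret H: resistor_network "del_arc e" L
    by (rule resistor_network_del_arc)
  have "\<not> unseparated (del_arc e) (tail G e) (head G e)"
  proof
    assume "unseparated (del_arc e) (tail G e) (head G e)"
    then have "unseparated (del_arc e) p q" if "unseparated G p q" for p q
      using that e unfolding unseparated_def by (simp add: arc_closed_del_arc_iff)
    then show False
      using assms connected_G connected_iff_unseparated H.connected_iff_unseparated by simp
  qed
  then obtain S where S: "arc_closed (del_arc e) S" "tail G e \<in> S" "head G e \<notin> S"
    by (rule not_unseparatedE)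
  show ?thesis
    using effective_resistance_eq[OF unit_current_potential_bridge[OF e S]] e S by simp
qed

lemma effective_resistance_nonneg:
  assumes "p \<in> verts G" "q \<in> verts G"
  shows "0 \<le> effective_resistance G L p q"
proof -
  obtain f where "unit_current_potential G L p q f" "effective_resistance G L p q = f p - f q"
    using assms by (rule obtain_potential)
  then show ?thesis
    using potential_nonneg assms by simp
qed

text \<open>For \<open>p\<close>, \<open>q\<close> the ends of \<open>e\<close>, the potential drop
  across \<open>e\<close> in the perturbation formula is \<open>R\<close> itself, which gives the
  parallel resistance \<open>R - R^2 / (L e + R)\<close>.\<close>

lemma effective_resistance_parallel:
  assumes e: "e \<in> arcs G" and conn: "Digraph_Component.connected (del_arc e)"
  defines "R \<equiv> effective_resistance (del_arc e) L (tail G e) (head G e)"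
  shows "(L e)\<^sup>2 / (L e + R) = L e - effective_resistance G L (tail G e) (head G e)"
proof -
  interpret H: metrized_graph "del_arc e" L
    using conn by (rule metrized_graph_del_arc)
  obtain h where h: "unit_current_potential (del_arc e) L (tail G e) (head G e) h"
    and R: "R = h (tail G e) - h (head G e)"
    using H.obtain_potential[of "tail G e" "head G e"] e unfolding R_def by auto
  have "0 \<le> R"
    using H.effective_resistance_nonneg[of "tail G e" "head G e"] e unfolding R_def by simp
  then have "L e + R > 0"
    using length_pos[OF e] by simp
  moreover have "l\<^sup>2 / (l + r) = l - (r - r\<^sup>2 / (l + r))" if "l + r > 0" for l r :: real
    using that by (simp add: divide_simps) (simp add: algebra_simps power2_eq_square)
  ultimately have "(L e)\<^sup>2 / (L e + R) = L e - (R - R\<^sup>2 / (L e + R))"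
    by blast
  also have "R - R\<^sup>2 / (L e + R) = effective_resistance G L (tail G e) (head G e)"
    using effective_resistance_del_arc[OF e conn tail_in_verts[OF e] head_in_verts[OF e] h]
    by (simp only: R_def[symmetric] R[symmetric])
  finally show ?thesis .
qed

text \<open>This form is affine in the resistances and treats bridges like all other edges.\<close>

lemma z_invariant_eq:
  "z_invariant G L = (\<Sum>e\<in>arcs G. L e - effective_resistance G L (tail G e) (head G e))"
  unfolding z_invariant_def
proof (intro sum.cong refl)
  fix e assume e: "e \<in> arcs G"
  show "(if edge_resistance G L e = \<infinity> then 0
      else (L e)\<^sup>2 / (L e + real_of_ereal (edge_resistance G L e))) =
    L e - effective_resistance G L (tail G e) (head G e)"
  proof (cases "Digraph_Component.connected (del_arc e)")
    case True
    then show ?thesis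
      using effective_resistance_parallel[OF e True] by (simp add: edge_resistance_def)
  next
    case False
    then show ?thesis
      using effective_resistance_bridge[OF e False] by (simp add: edge_resistance_def)
  qed
qed

section \<open>Contraction of an arc\<close>

lemma metrized_graph_contract_arc:
  assumes e: "e \<in> arcs G"
  shows "metrized_graph (contract_arc G e) L"
proof -
  define \<pi> where "\<pi> v = (if v = head G e then tail G e else v)" for v
  have C: "verts (contract_arc G e) = \<pi> ` verts G" "arcs (contract_arc G e) = arcs G - {e}"
    "tail (contract_arc G e) j = \<pi> (tail G j)" "head (contract_arc G e) j = \<pi> (head G j)" for j
    by (simp_all add: contract_arc_def Let_def \<pi>_def)
  interpret C: fin_digraph "contract_arc G e"
    by unfold_locales (simp_all add: C)
  have "unseparated (contract_arc G e) (\<pi> p) (\<pi> q)"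
    if pq: "p \<in> verts G" "q \<in> verts G" for p q
    unfolding unseparated_def
  proof (intro allI impI)
    fix T assume T: "arc_closed (contract_arc G e) T"
    \<comment> \<open>Closed sets of the contraction pull back along \<open>\<pi>\<close> to closed
      sets of \<open>G\<close>; the arc \<open>e\<close> causes no trouble because
      \<open>\<pi>\<close> identifies its ends.\<close>
    have "tail G j \<in> \<pi> -` T \<longleftrightarrow> head G j \<in> \<pi> -` T" if j: "j \<in> arcs G" for j
    proof (cases "j = e")
      case True
      then show ?thesis
        by (simp add: \<pi>_def)
    next
      case False
      then show ?thesis
        using T j by (simp add: arc_closed_def C)
    qed
    then have "arc_closed G (\<pi> -` T)"
      unfolding arc_closed_def by (rule ballI)
    with verts_unseparated[OF pq] have "p \<in> \<pi> -` T \<longleftrightarrow> q \<in> \<pi> -` T"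
      by (simp only: unseparated_def)
    then show "\<pi> p \<in> T \<longleftrightarrow> \<pi> q \<in> T"
      by simp
  qed
  moreover have "verts G \<noteq> {}"
    using tail_in_verts[OF e] by auto
  ultimately have "Digraph_Component.connected (contract_arc G e)"
    by (simp add: C.connected_iff_unseparated C)
  then show ?thesis
    by unfold_locales (simp_all add: C length_pos)
qed

text \<open>As \<open>f\<close> agrees at the ends of \<open>e\<close>, contraction changes no arc
  current, and the merged vertex, named \<open>tail G e\<close>, collects the net currents of both
  ends.\<close>

lemma net_current_contract_arc:
  assumes e: "e \<in> arcs G" and eq: "f (tail G e) = f (head G e)"
    and ne: "tail G e \<noteq> head G e" and v: "v \<noteq> head G e"
  shows "net_current (contract_arc G e) L f v =
    net_current (del_arc e) L f v +
    (if v = tail G e then net_current (del_arc e) L f (head G e) else 0)"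
proof -
  interpret C: metrized_graph "contract_arc G e" L
    using e by (rule metrized_graph_contract_arc)
  interpret H: resistor_network "del_arc e" L
    by (rule resistor_network_del_arc)
  have arcs: "arcs (contract_arc G e) = arcs (del_arc e)"
    by (simp add: contract_arc_def Let_def)
  have f: "f (tail (contract_arc G e) j) = f (tail G j)"
    "f (head (contract_arc G e) j) = f (head G j)" for j
    using eq by (simp_all add: contract_arc_def Let_def)
  have ends: "v = tail (contract_arc G e) j \<longleftrightarrow>
      v = tail G j \<or> v = tail G e \<and> tail G j = head G e"
    "v = head (contract_arc G e) j \<longleftrightarrow>
      v = head G j \<or> v = tail G e \<and> head G j = head G e" for j
    using v by (auto simp: contract_arc_def Let_def)
  show ?thesis
  proof (cases "v = tail G e")
    case True
    then show ?thesis
      unfolding C.net_current_eq_sum_arcs H.net_current_eq_sum_arcs arcs f ends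
        if_P[OF True] sum.distrib[symmetric]
      by (intro sum.cong refl) (use True ne in \<open>auto simp: add_divide_distrib[symmetric]\<close>)
  next
    case False
    then show ?thesis
      unfolding C.net_current_eq_sum_arcs H.net_current_eq_sum_arcs arcs f ends by simp
  qed
qed

text \<open>Formally the perturbation formula for a wire of length 0 in place of \<open>e\<close>.
  Distinct ends make the denominator positive.\<close>

lemma effective_resistance_contract_arc:
  assumes e: "e \<in> arcs G" and conn: "Digraph_Component.connected (del_arc e)"
    and ne: "tail G e \<noteq> head G e" and pq: "p \<in> verts G" "q \<in> verts G"
    and h: "unit_current_potential (del_arc e) L p q h"
  defines "\<pi> \<equiv> \<lambda>v. if v = head G e then tail G e else v"
  shows "effective_resistance (contract_arc G e) L (\<pi> p) (\<pi> q) =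
    h p - h q - (h (tail G e) - h (head G e))\<^sup>2 /
      effective_resistance (del_arc e) L (tail G e) (head G e)"
proof -
  interpret C: metrized_graph "contract_arc G e" L
    using e by (rule metrized_graph_contract_arc)
  interpret H: metrized_graph "del_arc e" L
    using conn by (rule metrized_graph_del_arc)
  let ?a = "tail G e" and ?b = "head G e"
  have ab: "?a \<in> verts G" "?b \<in> verts G"
    using e by auto
  obtain g where g: "unit_current_potential (del_arc e) L ?a ?b g"
    and R: "effective_resistance (del_arc e) L ?a ?b = g ?a - g ?b"
    using H.obtain_potential[of ?a ?b] e by auto
  have R_pos: "0 < g ?a - g ?b"
    using H.potential_pos[OF g] ab ne by simp
  have s: "h ?a - h ?b = g p - g q"
    using H.reciprocity[OF h _ _ g] pq ab by simp
  \<comment> \<open>This factor makes the drop of \<open>h + t * g\<close> across \<open>e\<close>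
    vanish, so that the potential is compatible with merging the ends.\<close>
  define t where "t = - (h ?a - h ?b) / (g ?a - g ?b)"
  define f where "f = (\<lambda>v. h v + t * g v)"
  have "t * (g ?a - g ?b) = - (h ?a - h ?b)"
    using R_pos by (simp add: t_def)
  then have f_eq: "f ?a = f ?b"
    by (simp add: f_def algebra_simps)
  have cur: "net_current (del_arc e) L f v =
      (if v = p then 1 else 0) - (if v = q then 1 else 0) +
      t * ((if v = ?a then 1 else 0) - (if v = ?b then 1 else 0))" if "v \<in> verts G" for v
    using g h that unfolding f_def H.net_current_add_mult
    by (simp add: unit_current_potential_def)
  have "unit_current_potential (contract_arc G e) L (\<pi> p) (\<pi> q) f"
    unfolding unit_current_potential_def
  proof
    fix v assume "v \<in> verts (contract_arc G e)"
    then have "v \<in> verts G" "v \<noteq> ?b"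
      using e ne by (auto simp: contract_arc_def Let_def split: if_splits)
    then show "net_current (contract_arc G e) L f v =
        (if v = \<pi> p then 1 else 0) - (if v = \<pi> q then 1 else 0)"
      \<comment> \<open>The extra sources \<open>t\<close> at \<open>?a\<close> and
        \<open>- t\<close> at \<open>?b\<close> cancel at the merged vertex.\<close>
      unfolding net_current_contract_arc[OF e f_eq ne \<open>v \<noteq> ?b\<close>]
      using cur ab ne by (auto simp: \<pi>_def)
  qed
  moreover have "\<pi> p \<in> verts (contract_arc G e)" "\<pi> q \<in> verts (contract_arc G e)"
    using pq by (auto simp: contract_arc_def Let_def \<pi>_def)
  ultimately have "effective_resistance (contract_arc G e) L (\<pi> p) (\<pi> q) = f (\<pi> p) - f (\<pi> q)"
    by (rule C.effective_resistance_eq)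
  also have "\<dots> = f p - f q"
    using f_eq by (simp add: \<pi>_def)
  also have "\<dots> = h p - h q + t * (g p - g q)"
    by (simp add: f_def algebra_simps)
  also have "\<dots> = h p - h q - (h ?a - h ?b)\<^sup>2 / (g ?a - g ?b)"
    unfolding s[symmetric] t_def power2_eq_square by (simp del: minus_diff_eq)
  finally show ?thesis
    unfolding R .
qed

text \<open>The weights add up to 1, and for \<open>R > 0\<close> the weighted correction from the
  contraction is \<open>R / (L e + R) * (s^2 / R) = s^2 / (L e + R)\<close>, the one for
  \<open>G\<close>.\<close>

lemma effective_resistance_deletion_contraction:
  assumes e: "e \<in> arcs G" and conn: "Digraph_Component.connected (del_arc e)"
    and pq: "p \<in> verts G" "q \<in> verts G"
  defines "R \<equiv> effective_resistance (del_arc e) L (tail G e) (head G e)"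
    and "\<pi> \<equiv> \<lambda>v. if v = head G e then tail G e else v"
  shows "effective_resistance G L p q =
    L e / (L e + R) * effective_resistance (del_arc e) L p q +
    R / (L e + R) * effective_resistance (contract_arc G e) L (\<pi> p) (\<pi> q)"
proof -
  interpret H: metrized_graph "del_arc e" L
    using conn by (rule metrized_graph_del_arc)
  let ?a = "tail G e" and ?b = "head G e"
  have ab: "?a \<in> verts G" "?b \<in> verts G"
    using e by auto
  obtain h where h: "unit_current_potential (del_arc e) L p q h"
    and r: "effective_resistance (del_arc e) L p q = h p - h q"
    using H.obtain_potential[of p q] pq by auto
  note G_eq = effective_resistance_del_arc[OF e conn pq h, folded R_def]
  have L: "0 < L e"
    using e by (rule length_pos)
  show ?thesis
  proof (cases "?a = ?b")
    case True
    \<comment> \<open>For a loop the contraction has weight 0, and the drop across \<open>e\<close>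
      vanishes too.\<close>
    then have "R = 0"
      using H.obtain_potential[of ?a ?b] ab unfolding R_def by auto
    then show ?thesis
      using True L G_eq r by simp
  next
    case False
    obtain g where "unit_current_potential (del_arc e) L ?a ?b g" "R = g ?a - g ?b"
      using H.obtain_potential[of ?a ?b] ab unfolding R_def by auto
    then have "0 < R"
      using H.potential_pos[of ?a ?b g] ab False by simp
    then show ?thesis
      unfolding G_eq r \<pi>_def effective_resistance_contract_arc[OF e conn False pq h, folded R_def]
      using L by (simp add: divide_simps) (simp add: algebra_simps)
  qed
qed

end

section \<open>Summation over the edges\<close>

theorem theorem4p7:
  fixes \<Gamma> :: "('a, 'b) pre_digraph" and L :: "'b \<Rightarrow> real" and i :: 'b
  assumes "metrized_graph \<Gamma> L"
    and "i \<in> arcs \<Gamma>"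
    and "Digraph_Component.connected (pre_digraph.del_arc \<Gamma> i)"
  defines "R \<equiv> real_of_ereal (edge_resistance \<Gamma> L i)"
  shows "z_invariant \<Gamma> L =
           (L i)\<^sup>2 / (L i + R)
           + L i / (L i + R) * z_invariant (pre_digraph.del_arc \<Gamma> i) L
           + R / (L i + R) * z_invariant (contract_arc \<Gamma> i) L"
proof -
  interpret metrized_graph \<Gamma> L
    by (fact assms(1))
  interpret H: metrized_graph "del_arc i" L
    using assms(3) by (rule metrized_graph_del_arc)
  interpret C: metrized_graph "contract_arc \<Gamma> i" L
    using assms(2) by (rule metrized_graph_contract_arc)
  have R: "R = effective_resistance (del_arc i) L (tail \<Gamma> i) (head \<Gamma> i)"
    using assms(3) by (simp add: R_def edge_resistance_def)
  have "0 \<le> R"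
    using H.effective_resistance_nonneg[of "tail \<Gamma> i" "head \<Gamma> i"] assms(2) by (simp add: R)
  then have weights: "L i / (L i + R) + R / (L i + R) = 1"
    using length_pos[OF assms(2)] by (simp add: add_divide_distrib[symmetric])
  let ?A = "arcs \<Gamma> - {i}"
  let ?r = "\<lambda>G j. effective_resistance G L (tail G j) (head G j)"
  have "L j - ?r \<Gamma> j =
      L i / (L i + R) * (L j - ?r (del_arc i) j) +
      R / (L i + R) * (L j - ?r (contract_arc \<Gamma> i) j)" if "j \<in> ?A" for j
  proof -
    \<comment> \<open>The ends of \<open>j\<close> in the contraction are the images under
      \<open>\<pi>\<close> of its ends in \<open>\<Gamma>\<close>, as the resistance identity
      requires.\<close>
    have "?r \<Gamma> j = L i / (L i + R) * ?r (del_arc i) j + R / (L i + R) * ?r (contract_arc \<Gamma> i) j"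
      using effective_resistance_deletion_contraction[OF assms(2,3), of "tail \<Gamma> j" "head \<Gamma> j"] that
      by (simp add: R contract_arc_def Let_def)
    \<comment> \<open>The weights sum to 1, so the length splits in the same proportion as the
      resistance.\<close>
    moreover have "L j = L i / (L i + R) * L j + R / (L i + R) * L j"
      unfolding distrib_right[symmetric] weights by simp
    ultimately show ?thesis
      unfolding right_diff_distrib by linarith
  qed
  then have "(\<Sum>j\<in>?A. L j - ?r \<Gamma> j) =
      L i / (L i + R) * (\<Sum>j\<in>?A. L j - ?r (del_arc i) j) +
      R / (L i + R) * (\<Sum>j\<in>?A. L j - ?r (contract_arc \<Gamma> i) j)"
    unfolding sum_distrib_left sum.distrib[symmetric] by (intro sum.cong refl)
  moreover have "arcs (contract_arc \<Gamma> i) = ?A"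
    by (simp add: contract_arc_def Let_def)
  \<comment> \<open>The edge \<open>i\<close> occurs only in \<open>\<Gamma>\<close>; by the
    parallel law its term is the first summand of the claim.\<close>
  moreover have "z_invariant \<Gamma> L = (L i)\<^sup>2 / (L i + R) + (\<Sum>j\<in>?A. L j - ?r \<Gamma> j)"
    unfolding z_invariant_eq R effective_resistance_parallel[OF assms(2,3)]
    by (rule sum.remove[OF finite_arcs assms(2)])
  ultimately show ?thesis
    unfolding H.z_invariant_eq C.z_invariant_eq by simp
qed

end
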